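(* Almost surely, for all $i\in\mathcal{B}$ with $Z_i<\infty$: (i) $S_{Z_i^-}(i)\subseteq\mathcal{R}(Z_i)$; (ii) $|S_{Z_i^-}(i)|=\infty$.
   Context: $\mathcal{B}$ is the infinite 3-regular tree (Bethe lattice), identified with its set of sites (vertices); for a site $i$, $\partial\{i\}$ denotes the set of its three neighbours. Let $I=[1/2,1]\cup\{\infty\}$. The function $\Phi: I\times I\times[0,1]\to I$ is defined by $\Phi(x,y,z)=x$ if $x\ge z$; $\Phi(x,y,z)=y$ if $x<z\le y$; and $\Phi(x,y,z)=\infty$ otherwise. $F$ is the distribution function of an $I$-valued random variable given by $F(t)=0$ for $t\le 1/2$, $F(t)=\ln(2t)$ for $1/2<t\le 1$, $F(t)=\ln 2$ for $1<t<\infty$, $F(\infty)=1$ (atom of mass $1-\ln 2$ at $\infty$). The family $((U_i,Y_{i\to j}):i\in\mathcal{B},j\in\partial\{i\})$ has a joint law that is invariant under automorphisms of $\mathcal{B}$, with the $U_i$ i.i.d. uniform on $[0,1]$ and the $Y_{i\to j}$ being $I$-valued, such that for all $i\in\mathcal{B}$, $j\in\partial\{i\}$: (1) $Y_{j\to i}$ has distribution function $F$; (2) $Y_{j\to i}=\Phi(\min(Y_{i\to k},Y_{i\to l}),\max(Y_{i\to k},Y_{i\to l}),U_i)$ a.s., where $\{k,l\}=\partial\{i\}\setminus\{j\}$; and (3) for each finite connected $S\subset\mathcal{B}$, the variables $(Y_{i\to j}:i\in S,j\notin S,j\in\partial\{i\})$ are independent of each other and of $(U_i:i\in S)$. (Such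 a law exists.) For $i\in\mathcal{B}$ define $Z_i=\min\{Y_{j\to i}:j\in\partial\{i\}\}=\min\{Y_{i\to j}:j\in\partial\{i\},\,Y_{i\to j}\ge U_i\}$ (the two expressions agree a.s. by (2)), with $Z_i=\infty$ if the last set is empty. For $t\in[0,1]$ define $\mathcal{W}(t)=\{i:U_i>t\}$ (white sites, at rest), $\mathcal{G}(t)=\{i:U_i\le t,\ Z_i>t\}$ (green sites, active), $\mathcal{R}(t)=\{i:Z_i\le t\}$ (red sites, frozen). $S_s(i)$ denotes the cluster (connected component in $\mathcal{B}$) of $i$ in $\mathcal{G}(s)$, as a set of sites; $S_{s^-}(i)$ denotes the cluster of $i$ in $\mathcal{G}(s^-)=\{j:U_j<s\le Z_j\}$, the set of sites that are green just before time $s$. *)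

theory Defs
  imports "HOL-Probability.Probability"
begin

text \<open>A simple undirected graph is given by its adjacency relation on the type of all its sites.\<close>

definition nbrs :: "('v \<Rightarrow> 'v \<Rightarrow> bool) \<Rightarrow> 'v \<Rightarrow> 'v set" where
  "nbrs adj i = {j. adj i j}"

text \<open>The cluster of \<open>i\<close> in \<open>A\<close> is empty if \<open>i \<notin> A\<close>.\<close>

definition cluster :: "('v \<Rightarrow> 'v \<Rightarrow> bool) \<Rightarrow> 'v set \<Rightarrow> 'v \<Rightarrow> 'v set" where
  "cluster adj A i = {j. i \<in> A \<and> (\<lambda>x y. adj x y \<and> x \<in> A \<and> y \<in> A)\<^sup>*\<^sup>* i j}"

definition connected_sites :: "('v \<Rightarrow> 'v \<Rightarrow> bool) \<Rightarrow> 'v set \<Rightarrow> bool" where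
  "connected_sites adj S \<longleftrightarrow> (\<forall>i\<in>S. cluster adj S i = S)"

definition acyclic_graph :: "('v \<Rightarrow> 'v \<Rightarrow> bool) \<Rightarrow> bool" where
  "acyclic_graph adj \<longleftrightarrow>
     \<not> (\<exists>xs. length xs \<ge> 3 \<and> distinct xs \<and> successively adj xs \<and> adj (last xs) (hd xs))"

definition bethe_lattice :: "('v \<Rightarrow> 'v \<Rightarrow> bool) \<Rightarrow> bool" where
  "bethe_lattice adj \<longleftrightarrow>
     symp adj \<and> irreflp adj \<and> connected_sites adj UNIV \<and> acyclic_graph adj \<and>
     (\<forall>i. card (nbrs adj i) = 3)"

definition automorphism :: "('v \<Rightarrow> 'v \<Rightarrow> bool) \<Rightarrow> ('v \<Rightarrow> 'v) \<Rightarrow> bool" where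
  "automorphism adj \<phi> \<longleftrightarrow> bij \<phi> \<and> (\<forall>i j. adj (\<phi> i) (\<phi> j) \<longleftrightarrow> adj i j)"

definition directed_edges :: "('v \<Rightarrow> 'v \<Rightarrow> bool) \<Rightarrow> ('v \<times> 'v) set" where
  "directed_edges adj = {(i, j). adj i j}"

definition out_edges :: "('v \<Rightarrow> 'v \<Rightarrow> bool) \<Rightarrow> 'v set \<Rightarrow> ('v \<times> 'v) set" where
  "out_edges adj S = {(i, j). i \<in> S \<and> j \<notin> S \<and> adj i j}"

definition freeze_times :: "ereal set" where
  "freeze_times = {ereal (1/2) .. 1} \<union> {\<infinity>}"

definition Phi :: "ereal \<Rightarrow> ereal \<Rightarrow> real \<Rightarrow> ereal" where
  "Phi x y z = (if x \<ge> ereal z then x else if ereal z \<le> y then y else \<infinity>)"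

definition F :: "ereal \<Rightarrow> real" where
  "F t = (if t \<le> ereal (1/2) then 0
          else if t \<le> 1 then ln (2 * real_of_ereal t)
          else if t < \<infinity> then ln 2
          else 1)"

text \<open>
  The variable \<open>Y i j\<close> is \<open>Y\<^bsub>i\<rightarrow>j\<^esub>\<close>; its value is irrelevant unless \<open>i\<close> and \<open>j\<close> are adjacent.
  The joint law is that of the family relabelled along \<open>\<phi>\<close>, on sites and adjacent ordered pairs.
\<close>

definition joint_law ::
  "('v \<Rightarrow> 'v \<Rightarrow> bool) \<Rightarrow> 'w measure \<Rightarrow> ('v \<Rightarrow> 'w \<Rightarrow> real) \<Rightarrow> ('v \<Rightarrow> 'v \<Rightarrow> 'w \<Rightarrow> ereal) \<Rightarrow>
   ('v \<Rightarrow> 'v) \<Rightarrow> (('v \<Rightarrow> real) \<times> ('v \<times> 'v \<Rightarrow> ereal)) measure" where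
  "joint_law adj M U Y \<phi> =
     distr M (PiM UNIV (\<lambda>_. borel) \<Otimes>\<^sub>M PiM (directed_edges adj) (\<lambda>_. borel))
       (\<lambda>\<omega>. (\<lambda>i. U (\<phi> i) \<omega>, \<lambda>(i, j)\<in>directed_edges adj. Y (\<phi> i) (\<phi> j) \<omega>))"

text \<open>
  Independence of two random variables with values in different types, which the library's
  \<open>indep_var\<close> does not cover: the generated sigma-algebras are independent.
\<close>

definition indep_rvs ::
  "'w measure \<Rightarrow> 'a measure \<Rightarrow> ('w \<Rightarrow> 'a) \<Rightarrow> 'b measure \<Rightarrow> ('w \<Rightarrow> 'b) \<Rightarrow> bool" where
  "indep_rvs M N X N' X' \<longleftrightarrow>
     X \<in> measurable M N \<and> X' \<in> measurable M N' \<and>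
     prob_space.indep_set M (sets (vimage_algebra (space M) X N)) (sets (vimage_algebra (space M) X' N'))"

definition Z ::
  "('v \<Rightarrow> 'v \<Rightarrow> bool) \<Rightarrow> ('v \<Rightarrow> 'v \<Rightarrow> 'w \<Rightarrow> ereal) \<Rightarrow> 'v \<Rightarrow> 'w \<Rightarrow> ereal" where
  "Z adj Y i \<omega> = Min ((\<lambda>j. Y j i \<omega>) ` nbrs adj i)"

definition red ::
  "('v \<Rightarrow> 'v \<Rightarrow> bool) \<Rightarrow> ('v \<Rightarrow> 'v \<Rightarrow> 'w \<Rightarrow> ereal) \<Rightarrow> ereal \<Rightarrow> 'w \<Rightarrow> 'v set" where
  "red adj Y t \<omega> = {i. Z adj Y i \<omega> \<le> t}"

text \<open>The set of sites that are green just before time \<open>s\<close>.\<close>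

definition green_before ::
  "('v \<Rightarrow> 'v \<Rightarrow> bool) \<Rightarrow> ('v \<Rightarrow> 'w \<Rightarrow> real) \<Rightarrow> ('v \<Rightarrow> 'v \<Rightarrow> 'w \<Rightarrow> ereal) \<Rightarrow>
   ereal \<Rightarrow> 'w \<Rightarrow> 'v set" where
  "green_before adj U Y s \<omega> = {j. ereal (U j \<omega>) < s \<and> s \<le> Z adj Y j \<omega>}"

end

theory Submission
  imports Defs
begin

text \<open>
  Almost surely, for every site \<open>i\<close> the recursion holds on all incident edges and \<open>U\<^sub>i\<close> differs from
  every \<open>Y\<^bsub>i\<rightarrow>j\<^esub>\<close>. On this event, a finite value \<open>s\<close> of \<open>Y\<^bsub>j\<rightarrow>i\<^esub>\<close> is always
  inherited from some \<open>Y\<^bsub>i\<rightarrow>k\<^esub> = s > U\<^sub>i\<close> with \<open>k \<noteq> j\<close>. Iterating this from a site with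
  \<open>Z\<^sub>i = s\<close> gives a non-backtracking, hence injective, ray on which \<open>Z\<close> is constantly \<open>s\<close>; this ray
  lies in the cluster, which is therefore infinite. The same exchange of values across an edge shows
  that \<open>Z = s\<close> spreads to every neighbour in \<open>\<G>(s\<^sup>-)\<close>, so the whole cluster freezes at \<open>s\<close>.
\<close>

section \<open>Countability and cycle-freeness of the lattice\<close>

lemma bethe_lattice_countable:
  fixes adj :: "'v \<Rightarrow> 'v \<Rightarrow> bool"
  assumes "bethe_lattice adj"
  shows "countable (UNIV :: 'v set)"
proof -
  fix i :: 'v
  have fin: "finite (nbrs adj x)" for x
    using assms by (metis bethe_lattice_def card.infinite zero_neq_numeral)
  have "cluster adj UNIV i = UNIV"
    using assms by (auto simp: bethe_lattice_def connected_sites_def)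
  then have "j \<in> {(x, y). adj x y}\<^sup>* `` {i}" for j
    by (auto simp: cluster_def set_eq_iff rtranclp_rtrancl_eq)
  then have "UNIV = {(x, y). adj x y}\<^sup>* `` {i}"
    by auto
  \<comment> \<open>Reachability from one site preserves countability because each site has only
    finitely many neighbours.\<close>
  moreover have "countable ({(x, y). adj x y}\<^sup>* `` {i})"
  proof (rule countable_rtrancl)
    fix X :: "'v set" assume "countable X"
    moreover have "{(x, y). adj x y} `` X = (\<Union>x\<in>X. nbrs adj x)"
      by (auto simp: nbrs_def)
    ultimately show "countable ({(x, y). adj x y} `` X)"
      using fin by (simp del: Image_Collect_case_prod add: countable_finite)
  qed auto
  ultimately show ?thesis by simp
qed

text \<open>A repetition \<open>f m = f (m + d)\<close> with \<open>d\<close> minimal closes a cycle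
  of distinct sites. Acyclicity forbids this for \<open>d\<close> at least 3, irreflexivity excludes
  \<open>d = 1\<close>, and the absence of backtracking excludes \<open>d = 2\<close>.\<close>

lemma acyclic_graph_nonbacktracking_inj:
  fixes f :: "nat \<Rightarrow> 'v"
  assumes acyclic: "acyclic_graph adj" and irrefl: "irreflp adj"
    and step: "\<And>n. adj (f n) (f (Suc n))" and nonback: "\<And>n. f (Suc (Suc n)) \<noteq> f n"
  shows "inj f"
proof (rule ccontr)
  assume "\<not> inj f"
  then obtain a b where "a < b" "f a = f b"
    by (metis injI linorder_neqE_nat)
  then have ex: "\<exists>d. 0 < d \<and> (\<exists>m. f m = f (m + d))"
    by (intro exI[of _ "b - a"] conjI exI[of _ a]) auto
  define d where "d = (LEAST d. 0 < d \<and> (\<exists>m. f m = f (m + d)))"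
  obtain m where d: "0 < d" "f m = f (m + d)"
    using LeastI_ex[OF ex] unfolding d_def by blast
  have least: "f k \<noteq> f (k + e)" if "0 < e" "e < d" for k e
    using not_less_Least[of e "\<lambda>d. 0 < d \<and> (\<exists>m. f m = f (m + d))"] that
    unfolding d_def by blast
  have "d \<noteq> 1"
    using d step[of m] irrefl by (auto simp: irreflp_def)
  moreover have "d \<noteq> 2"
    using d nonback[of m] by auto
  ultimately have "d \<ge> 3" using d(1) by linarith
  let ?xs = "map f [m..<m + d]"
  have "inj_on f {m..<m + d}"
  proof (rule linorder_inj_onI)
    fix x y assume "x < y" "x \<in> {m..<m + d}" "y \<in> {m..<m + d}"
    then show "f x \<noteq> f y"
      using least[of "y - x" x] by auto
  qed auto
  then have "distinct ?xs"
    by (simp add: distinct_map)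
  moreover have "successively adj ?xs"
    using step by (auto simp: successively_conv_nth)
  moreover have "adj (last ?xs) (hd ?xs)"
  proof -
    \<comment> \<open>The head \<open>f m\<close> equals \<open>f (m + d)\<close>, so the closing
      edge is just the step that starts at index \<open>m + d - 1\<close>.\<close>
    have "last ?xs = f (m + d - 1)" "hd ?xs = f (m + d)"
      using d by (auto simp: last_map hd_map)
    then show ?thesis
      using step[of "m + d - 1"] d(1) by simp
  qed
  ultimately show False
    using acyclic \<open>d \<ge> 3\<close> unfolding acyclic_graph_def by (metis add_diff_cancel_left' length_map length_upt)
qed

section \<open>Deterministic analysis at a fixed sample point without ties\<close>

locale frozen_configuration =
  fixes adj :: "'v \<Rightarrow> 'v \<Rightarrow> bool" and U :: "'v \<Rightarrow> 'w \<Rightarrow> real"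
    and Y :: "'v \<Rightarrow> 'v \<Rightarrow> 'w \<Rightarrow> ereal" and \<omega> :: 'w
  assumes tree: "bethe_lattice adj"
    and rec: "\<And>i j k l. adj i j \<Longrightarrow> {k, l} = nbrs adj i - {j} \<Longrightarrow>
       Y j i \<omega> = Phi (min (Y i k \<omega>) (Y i l \<omega>)) (max (Y i k \<omega>) (Y i l \<omega>)) (U i \<omega>)"
    and neq: "\<And>i j. adj i j \<Longrightarrow> Y i j \<omega> \<noteq> ereal (U i \<omega>)"
begin

lemma adj_sym: "adj i j \<Longrightarrow> adj j i"
  using tree by (auto simp: bethe_lattice_def symp_def)

lemma card_nbrs: "card (nbrs adj i) = 3"
  using tree by (auto simp: bethe_lattice_def)

lemma finite_nbrs: "finite (nbrs adj i)"
  using card_nbrs[of i] by (metis card.infinite zero_neq_numeral)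

lemma other_nbrs:
  assumes "adj i j"
  obtains k l where "{k, l} = nbrs adj i - {j}"
proof -
  have "card (nbrs adj i - {j}) = 2"
    using assms card_nbrs[of i] finite_nbrs[of i] by (simp add: nbrs_def)
  then show ?thesis
    using that by (metis card_2_iff)
qed

text \<open>\<open>Phi\<close>, applied to the minimum and maximum of two values, picks the least of
  them that is at least \<open>U i\<close>; every admissible outgoing value therefore bounds the
  result.\<close>

lemma Y_le:
  assumes "adj i j" "adj i k" "k \<noteq> j" "ereal (U i \<omega>) \<le> Y i k \<omega>"
  shows "Y j i \<omega> \<le> Y i k \<omega>"
proof -
  obtain a b where ab: "{a, b} = nbrs adj i - {j}"
    using other_nbrs[OF assms(1)] .
  then have "k = a \<or> k = b"
    using assms by (auto simp: nbrs_def)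
  then show ?thesis
    using rec[OF assms(1) ab] assms(4) by (auto simp: Phi_def min_def max_def)
qed

text \<open>A finite value of \<open>Phi\<close> is one of its first two arguments and is at least
  \<open>U i\<close>. Excluding ties makes this strict, as membership in \<open>green_before\<close>
  demands.\<close>

lemma Y_inherited:
  assumes "adj i j" "Y j i \<omega> < \<infinity>"
  obtains k where "adj i k" "k \<noteq> j" "Y i k \<omega> = Y j i \<omega>" "ereal (U i \<omega>) < Y j i \<omega>"
proof -
  obtain a b where ab: "{a, b} = nbrs adj i - {j}"
    using other_nbrs[OF assms(1)] .
  then have *: "adj i a" "a \<noteq> j" "adj i b" "b \<noteq> j"
    by (auto simp: nbrs_def)
  have "(Y i a \<omega> = Y j i \<omega> \<or> Y i b \<omega> = Y j i \<omega>) \<and> ereal (U i \<omega>) \<le> Y j i \<omega>"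
    using rec[OF assms(1) ab] assms(2) by (auto simp: Phi_def min_def max_def split: if_splits)
  then show ?thesis
    using * that neq[of i a] neq[of i b] by (metis order_le_less)
qed

lemma Z_le: "adj i j \<Longrightarrow> Z adj Y i \<omega> \<le> Y j i \<omega>"
  unfolding Z_def using finite_nbrs[of i] by (auto simp: nbrs_def)

lemma Z_attained:
  obtains j where "adj i j" "Z adj Y i \<omega> = Y j i \<omega>"
proof -
  have "nbrs adj i \<noteq> {}"
    using card_nbrs[of i] by auto
  then have "Z adj Y i \<omega> \<in> (\<lambda>j. Y j i \<omega>) ` nbrs adj i"
    unfolding Z_def using finite_nbrs[of i] by (intro Min_in) auto
  then show ?thesis
    using that by (auto simp: nbrs_def)
qed

text \<open>One half of the second description of \<open>Z\<close>: a finite minimum of the incoming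
  values is inherited from an outgoing one.\<close>

lemma Z_outgoing:
  assumes "Z adj Y i \<omega> < \<infinity>"
  obtains k where "adj i k" "Y i k \<omega> = Z adj Y i \<omega>" "ereal (U i \<omega>) < Z adj Y i \<omega>"
  by (metis Z_attained Y_inherited assms)

text \<open>The value sent from \<open>i\<close> comes in at \<open>k\<close>, which gives one
  inequality. A smaller \<open>Z\<close> at \<open>k\<close> would also be an outgoing value at
  \<open>k\<close>: sent to \<open>i\<close>, it would undercut the minimum at \<open>i\<close>;
  sent elsewhere, it would push \<open>Y i k\<close> down by the recursion at
  \<open>k\<close>.\<close>

lemma Z_next:
  assumes "adj i k" "Y i k \<omega> = Z adj Y i \<omega>" "Z adj Y i \<omega> < \<infinity>"
  shows "Z adj Y k \<omega> = Z adj Y i \<omega>"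
proof (rule antisym)
  show "Z adj Y k \<omega> \<le> Z adj Y i \<omega>"
    using Z_le[OF adj_sym[OF assms(1)]] assms(2) by simp
  show "Z adj Y i \<omega> \<le> Z adj Y k \<omega>"
  proof (rule ccontr)
    assume "\<not> ?thesis"
    then have less: "Z adj Y k \<omega> < Z adj Y i \<omega>" by simp
    then have "Z adj Y k \<omega> < \<infinity>" using assms(3) by auto
    then obtain p where p: "adj k p" "Y k p \<omega> = Z adj Y k \<omega>" "ereal (U k \<omega>) < Z adj Y k \<omega>"
      by (rule Z_outgoing)
    show False
    proof (cases "p = i")
      case True
      then show False using Z_le[OF assms(1)] p less by simp
    next
      case False
      then show False
        using Y_le[OF adj_sym[OF assms(1)] p(1)] p(2,3) assms(2) less
        by (metis less_imp_le not_le)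
    qed
  qed
qed

text \<open>The last two hypotheses say that \<open>j\<close> is green just before the freezing time
  of \<open>i\<close>. If \<open>i\<close> does not send its minimum to \<open>j\<close>, the
  recursion at \<open>i\<close> makes \<open>Y j i\<close> equal to it. This value exceeds
  \<open>U j\<close>, so the recursion at \<open>j\<close> keeps the incoming value from any other
  neighbour \<open>n\<close> below it.\<close>

lemma Z_spreads:
  assumes ij: "adj i j" and "Z adj Y i \<omega> < \<infinity>"
    and "ereal (U j \<omega>) < Z adj Y i \<omega>" and "Z adj Y i \<omega> \<le> Z adj Y j \<omega>"
  shows "Z adj Y j \<omega> = Z adj Y i \<omega>"
proof -
  obtain k where k: "adj i k" "Y i k \<omega> = Z adj Y i \<omega>" "ereal (U i \<omega>) < Z adj Y i \<omega>"
    using Z_outgoing[OF assms(2)] .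
  show ?thesis
  proof (cases "k = j")
    case True
    then show ?thesis using Z_next k assms(2) by blast
  next
    case False
    then have "Y j i \<omega> \<le> Z adj Y i \<omega>"
      using Y_le[OF ij k(1)] k by simp
    then have eq: "Y j i \<omega> = Z adj Y i \<omega>"
      using Z_le[OF ij] by simp
    obtain n where n: "adj j n" "n \<noteq> i"
      using other_nbrs[OF adj_sym[OF ij]] by (auto simp: nbrs_def)
    have "Z adj Y j \<omega> \<le> Y n j \<omega>"
      using Z_le[OF n(1)] .
    also have "\<dots> \<le> Y j i \<omega>"
      using Y_le[OF n(1) adj_sym[OF ij]] n(2) eq assms(3) by auto
    finally show ?thesis
      using eq assms(4) by simp
  qed
qed

lemma cluster_subset_red:
  assumes "Z adj Y i \<omega> < \<infinity>"
  shows "cluster adj (green_before adj U Y (Z adj Y i \<omega>) \<omega>) i \<subseteq> red adj Y (Z adj Y i \<omega>) \<omega>"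
proof
  fix j assume "j \<in> cluster adj (green_before adj U Y (Z adj Y i \<omega>) \<omega>) i"
  then have "(\<lambda>x y. adj x y \<and> x \<in> green_before adj U Y (Z adj Y i \<omega>) \<omega> \<and>
      y \<in> green_before adj U Y (Z adj Y i \<omega>) \<omega>)\<^sup>*\<^sup>* i j"
    by (simp add: cluster_def)
  \<comment> \<open>Equality, not merely the bound defining \<open>red\<close>, is what the
    induction along a path carries.\<close>
  then have "Z adj Y j \<omega> = Z adj Y i \<omega>"
  proof induction
    case (step x y)
    then show ?case
      using Z_spreads[of x y] assms by (auto simp: green_before_def)
  qed simp
  then show "j \<in> red adj Y (Z adj Y i \<omega>) \<omega>"
    by (simp add: red_def)
qed

lemma infinite_cluster:
  assumes fin: "Z adj Y i \<omega> < \<infinity>"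
  shows "infinite (cluster adj (green_before adj U Y (Z adj Y i \<omega>) \<omega>) i)"
proof -
  define s where "s = Z adj Y i \<omega>"
  define G where "G = green_before adj U Y s \<omega>"
  \<comment> \<open>\<open>P\<close> marks the edges along which the value \<open>s\<close> leaves a
    site freezing at \<open>s\<close>.\<close>
  define P where "P = (\<lambda>(x, y). adj x y \<and> Y x y \<omega> = s \<and> Z adj Y x \<omega> = s)"
  obtain k where "P (i, k)"
    using Z_outgoing[OF fin] by (auto simp: P_def s_def)
  have next_edge: "\<exists>z. P (y, z) \<and> z \<noteq> x" if "P (x, y)" for x y
  proof -
    have xy: "adj x y" "Y x y \<omega> = s" "Z adj Y x \<omega> = s"
      using that by (auto simp: P_def)
    obtain z where "adj y z" "z \<noteq> x" "Y y z \<omega> = s"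
      using Y_inherited[OF adj_sym[OF xy(1)]] xy(2) fin by (auto simp: s_def)
    moreover have "Z adj Y y \<omega> = s"
      using Z_next[OF xy(1)] xy fin by (simp add: s_def)
    ultimately show ?thesis by (auto simp: P_def)
  qed
  \<comment> \<open>The ray is chosen edge by edge, since avoiding backtracking requires remembering
    the previous site. The clause for \<open>n = 0\<close> fixes the starting edge.\<close>
  have "\<exists>e. \<forall>n. (P (e n) \<and> (n = 0 \<longrightarrow> e n = (i, k))) \<and>
      (fst (e (Suc n)) = snd (e n) \<and> snd (e (Suc n)) \<noteq> fst (e n))"
  proof (rule dependent_nat_choice)
    show "\<exists>x. P x \<and> (0 = (0::nat) \<longrightarrow> x = (i, k))"
      using \<open>P (i, k)\<close> by blast
    show "\<exists>y. (P y \<and> (Suc n = 0 \<longrightarrow> y = (i, k))) \<and> fst y = snd x \<and> snd y \<noteq> fst x"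
      if "P x \<and> (n = 0 \<longrightarrow> x = (i, k))" for x n
      using next_edge[of "fst x" "snd x"] that by auto
  qed
  then obtain e where e: "\<And>n. P (e n)" "e 0 = (i, k)"
      "\<And>n. fst (e (Suc n)) = snd (e n)" "\<And>n. snd (e (Suc n)) \<noteq> fst (e n)"
    by blast
  define f where "f n = fst (e n)" for n
  have adjf: "adj (f n) (f (Suc n))" and Zf: "Z adj Y (f n) \<omega> = s" for n
    using e(1)[of n] e(3)[of n] by (auto simp: f_def P_def split: prod.splits)
  have "inj f"
    using tree adjf e(3,4) unfolding bethe_lattice_def
    by (intro acyclic_graph_nonbacktracking_inj[of adj]) (auto simp: f_def)
  have fG: "f n \<in> G" for n
    using Z_outgoing[of "f n"] Zf[of n] fin by (auto simp: G_def green_before_def s_def)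
  have "(\<lambda>x y. adj x y \<and> x \<in> G \<and> y \<in> G)\<^sup>*\<^sup>* i (f n)" for n
  proof (induction n)
    case 0
    then show ?case by (simp add: f_def e(2))
  next
    case (Suc n)
    then show ?case
      using adjf[of n] fG by (auto intro: rtranclp.rtrancl_into_rtrancl)
  qed
  moreover have "i \<in> G"
    using fG[of 0] by (simp add: f_def e(2))
  ultimately have "range f \<subseteq> cluster adj G i"
    by (auto simp: cluster_def)
  then show ?thesis
    using \<open>inj f\<close> by (metis G_def s_def finite_subset range_inj_infinite)
qed

end

section \<open>Absence of ties from independence and atomless laws\<close>

lemma (in prob_space) AE_uniform_neq:
  fixes V :: "'a \<Rightarrow> real" and y :: ereal
  assumes "V \<in> borel_measurable M" "distr M borel V = uniform_measure lborel {0..1}"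
  shows "AE \<omega> in M. ereal (V \<omega>) \<noteq> y"
proof (cases y)
  case (real r)
  have "AE v in uniform_measure lborel {0..1}. v \<noteq> r"
    using AE_lborel_singleton[of r] by (auto intro!: AE_uniform_measureI)
  then have "AE \<omega> in M. V \<omega> \<noteq> r"
    unfolding assms(2)[symmetric] using assms(1) by (subst (asm) AE_distr_iff) auto
  then show ?thesis
    using real by simp
qed auto

text \<open>By independence the joint law is a product, so it suffices that \<open>V\<close> almost
  surely avoids each fixed value \<open>x\<close> of \<open>X\<close>.\<close>

lemma (in prob_space) indep_var_AE_neq:
  fixes X V :: "'a \<Rightarrow> ereal"
  assumes indep: "indep_var borel X borel V" and V: "\<And>y. AE \<omega> in M. V \<omega> \<noteq> y"
  shows "AE \<omega> in M. X \<omega> \<noteq> V \<omega>"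
proof -
  have [measurable]: "X \<in> borel_measurable M" "V \<in> borel_measurable M"
    using indep by (auto dest: indep_var_rv1 indep_var_rv2)
  interpret X: prob_space "distr M borel X" by (rule prob_space_distr) simp
  interpret V: prob_space "distr M borel V" by (rule prob_space_distr) simp
  interpret XV: pair_prob_space "distr M borel X" "distr M borel V" ..
  have "AE p in distr M borel X \<Otimes>\<^sub>M distr M borel V. fst p \<noteq> snd p"
  proof (rule XV.AE_pair_measure)
    show "{p \<in> space (distr M borel X \<Otimes>\<^sub>M distr M borel V). fst p \<noteq> snd p}
        \<in> sets (distr M borel X \<Otimes>\<^sub>M distr M borel V)"
      by measurable
    have "AE v in distr M borel V. x \<noteq> v" for x
      using V[of x] by (subst AE_distr_iff) auto
    then show "AE x in distr M borel X. AE v in distr M borel V. fst (x, v) \<noteq> snd (x, v)"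
      by simp
  qed
  then have "AE p in distr M (borel \<Otimes>\<^sub>M borel) (\<lambda>\<omega>. (X \<omega>, V \<omega>)). fst p \<noteq> snd p"
    using indep unfolding indep_var_distribution_eq by (simp only:)
  then show ?thesis
    by (subst (asm) AE_distr_iff) auto
qed

text \<open>Composition with measurable maps into a common type can only shrink the generated
  sigma-algebras, so independence survives.\<close>

lemma (in prob_space) indep_rvs_indep_var:
  assumes "indep_rvs M N X N' X'" "f \<in> measurable N K" "g \<in> measurable N' L"
  shows "indep_var K (f \<circ> X) L (g \<circ> X')"
proof -
  have X: "X \<in> measurable M N" "X' \<in> measurable M N'"
    and ind: "indep_set (sets (vimage_algebra (space M) X N)) (sets (vimage_algebra (space M) X' N'))"
    using assms(1) by (auto simp: indep_rvs_def)
  have pull: "h -` A \<inter> space M \<in> sets (vimage_algebra (space M) W Q)"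
    if "W \<in> measurable M Q" "k \<in> measurable Q R" "A \<in> sets R" "h = k \<circ> W" for h W Q k R A
  proof -
    have "h -` A \<inter> space M = W -` (k -` A \<inter> space Q) \<inter> space M"
      using measurable_space[OF that(1)] that(4) by auto
    then show ?thesis
      using in_vimage_algebra[OF measurable_sets[OF that(2,3)]] by metis
  qed
  have sub: "sigma_sets (space M) {h -` A \<inter> space M |A. A \<in> sets R} \<subseteq> sets (vimage_algebra (space M) W Q)"
    if "W \<in> measurable M Q" "k \<in> measurable Q R" "h = k \<circ> W" for h W Q k R
    using sets.sigma_sets_subset[of "{h -` A \<inter> space M |A. A \<in> sets R}" "vimage_algebra (space M) W Q"]
      pull[OF that(1,2) _ that(3)] by auto
  show ?thesis
    unfolding indep_var_eq
  proof (intro conjI)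
    show "indep_set (sigma_sets (space M) {(f \<circ> X) -` A \<inter> space M |A. A \<in> sets K})
       (sigma_sets (space M) {(g \<circ> X') -` A \<inter> space M |A. A \<in> sets L})"
      using ind sub[OF X(1) assms(2) refl] sub[OF X(2) assms(3) refl]
      unfolding indep_sets2_eq by blast
  qed (use X assms in auto)
qed

theorem lemma4p4:
  fixes adj :: "'v \<Rightarrow> 'v \<Rightarrow> bool"
    and M :: "'w measure"
    and U :: "'v \<Rightarrow> 'w \<Rightarrow> real"
    and Y :: "'v \<Rightarrow> 'v \<Rightarrow> 'w \<Rightarrow> ereal"
  assumes tree: "bethe_lattice adj"
    and prob: "prob_space M"
    and U_meas: "\<And>i. U i \<in> borel_measurable M"
    and U_unif: "\<And>i. distr M borel (U i) = uniform_measure lborel {0..1}"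
    and U_indep: "prob_space.indep_vars M (\<lambda>_. borel) U UNIV"
    and Y_meas: "\<And>i j. adj i j \<Longrightarrow> Y i j \<in> borel_measurable M"
    and Y_val: "\<And>i j \<omega>. adj i j \<Longrightarrow> \<omega> \<in> space M \<Longrightarrow> Y i j \<omega> \<in> freeze_times"
    and invariant: "\<And>\<phi>. automorphism adj \<phi> \<Longrightarrow> joint_law adj M U Y \<phi> = joint_law adj M U Y id"
    and Y_distr: "\<And>i j t. adj i j \<Longrightarrow> measure M {\<omega> \<in> space M. Y j i \<omega> \<le> t} = F t"
    and Y_rec: "\<And>i j k l. adj i j \<Longrightarrow> {k, l} = nbrs adj i - {j} \<Longrightarrow>
       AE \<omega> in M. Y j i \<omega> = Phi (min (Y i k \<omega>) (Y i l \<omega>)) (max (Y i k \<omega>) (Y i l \<omega>)) (U i \<omega>)"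
    and out_indep: "\<And>S. finite S \<Longrightarrow> connected_sites adj S \<Longrightarrow>
       prob_space.indep_vars M (\<lambda>_. borel) (\<lambda>(i, j). Y i j) (out_edges adj S)"
    and out_indep_U: "\<And>S. finite S \<Longrightarrow> connected_sites adj S \<Longrightarrow>
       indep_rvs M
         (PiM (out_edges adj S) (\<lambda>_. borel)) (\<lambda>\<omega>. \<lambda>(i, j)\<in>out_edges adj S. Y i j \<omega>)
         (PiM S (\<lambda>_. borel)) (\<lambda>\<omega>. \<lambda>i\<in>S. U i \<omega>)"
  shows "AE \<omega> in M. \<forall>i. Z adj Y i \<omega> < \<infinity> \<longrightarrow>
           cluster adj (green_before adj U Y (Z adj Y i \<omega>) \<omega>) i \<subseteq> red adj Y (Z adj Y i \<omega>) \<omega> \<and>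
           infinite (cluster adj (green_before adj U Y (Z adj Y i \<omega>) \<omega>) i)"
proof -
  interpret prob_space M by (rule prob)
  have cnt: "countable (X :: 'v set)" for X
    using bethe_lattice_countable[OF tree] by (rule countable_subset[rotated]) simp
  have neq: "AE \<omega> in M. Y i j \<omega> \<noteq> ereal (U i \<omega>)" if "adj i j" for i j
  proof -
    \<comment> \<open>The independence hypothesis is used for the one-point set \<open>{i}\<close>:
      without loops, the edge to \<open>j\<close> leaves it.\<close>
    have "i \<noteq> j"
      using tree that by (auto simp: bethe_lattice_def irreflp_def)
    then have e: "(i, j) \<in> out_edges adj {i}"
      using that by (auto simp: out_edges_def)
    have "connected_sites adj {i}"
      by (auto simp: connected_sites_def cluster_def elim: rtranclp.cases)
    \<comment> \<open>Coordinate projections extract \<open>Y i j\<close> and \<open>U i\<close>;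
      \<open>ereal\<close> brings the latter to the type of the former.\<close>
    then have "indep_var borel ((\<lambda>y. y (i, j)) \<circ> (\<lambda>\<omega>. \<lambda>(i, j)\<in>out_edges adj {i}. Y i j \<omega>))
        borel ((\<lambda>u. ereal (u i)) \<circ> (\<lambda>\<omega>. \<lambda>i\<in>{i}. U i \<omega>))"
      using e by (intro indep_rvs_indep_var[OF out_indep_U]) measurable
    then have "indep_var borel (Y i j) borel (\<lambda>\<omega>. ereal (U i \<omega>))"
      using e by (simp add: comp_def)
    then show ?thesis
      by (rule indep_var_AE_neq) (rule AE_uniform_neq[OF U_meas U_unif])
  qed
  have "AE \<omega> in M. \<forall>i\<in>UNIV. \<forall>j\<in>nbrs adj i. Y i j \<omega> \<noteq> ereal (U i \<omega>)"
    unfolding AE_ball_countable[OF cnt] using neq by (simp add: nbrs_def)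
  \<comment> \<open>The side condition on \<open>k\<close> and \<open>l\<close> becomes the range of
    \<open>l\<close>, so that every quantifier runs over a countable set and can be moved outside
    \<open>AE\<close>.\<close>
  moreover have "AE \<omega> in M. \<forall>i\<in>UNIV. \<forall>j\<in>nbrs adj i. \<forall>k\<in>UNIV. \<forall>l\<in>{l. {k, l} = nbrs adj i - {j}}.
      Y j i \<omega> = Phi (min (Y i k \<omega>) (Y i l \<omega>)) (max (Y i k \<omega>) (Y i l \<omega>)) (U i \<omega>)"
    unfolding AE_ball_countable[OF cnt] using Y_rec by (simp add: nbrs_def)
  ultimately show ?thesis
  proof eventually_elim
    case (elim \<omega>)
    interpret frozen_configuration adj U Y \<omega>
      by standard (use tree elim in \<open>auto simp: nbrs_def\<close>)
    show ?case
      using cluster_subset_red infinite_cluster by blast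
  qed
qed

end
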